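(* Let $S\equiv(S,\cdot,I,\lambda,\rho)$ be a partial semigroup, let $i,j\in I$, let $a\in S_{ji}$ be sandwich-regular, and let $b\in V(a)$. With $P^a$, $T_1$, $T_2$, $W$, $\phi_1$, $\phi_2$ as defined in the context, consider the map $$\psi:P^a\to T_1\times T_2,\qquad x\mapsto (xa,ax).$$ Then (i) $\psi$ is injective; (ii) $\operatorname{im}(\psi)=\{(g,h)\in T_1\times T_2 : ag=ha\}=\{(g,h)\in T_1\times T_2:\phi_1(g)=\phi_2(h)\}$. In particular, $P^a$ is (via $\psi$) a pullback product of $T_1$ and $T_2$ with respect to $W$ and the epimorphisms $\phi_1,\phi_2$.
   Context: A partial semigroup is a 5-tuple $(S,\cdot,I,\lambda,\rho)$ consisting of a class $S$, a partial binary operation $(x,y)\mapsto x\cdot y=xy$, a class $I$, and functions $\lambda,\rho:S\to I$ such that for all $x,y,z\in S$: (1) $xy$ is defined iff $x\rho=y\lambda$; (2) if $xy$ is defined then $(xy)\lambda=x\lambda$ and $(xy)\rho=y\rho$; (3) if $xy$ and $yz$ are defined then $(xy)z=x(yz)$; (4) for all $i,j\in I$, $S_{ij}=\{x\in S: x\lambda=i,\ x\rho=j\}$ is a set. (A locally small category is essentially a partial semigroup with identities.) For $x\in S$, $V(x)=\{y\in S: x=xyx,\ y=yxy\}$. $\operatorname{Reg}(S)=\{x\in S: x=xyx \text{ for some } y\in S\}$; likewise $\operatorname{Reg}(T)$ for a semigroup $T$. For $a\in S_{ji}$, the sandwich semigroup is $S_{ij}^a=(S_{ij},\star_a)$, where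 $x\star_a y=xay$. A regular element $a\in S_{ji}$ is sandwich-regular if $aS_{ij}a=\{axa:x\in S_{ij}\}\subseteq\operatorname{Reg}(S)$. Assume $a$ is sandwich-regular and $b\in V(a)$ (so $b\in S_{ij}$). Write: - $P^a=\operatorname{Reg}(S_{ij}^a)$, which is a subsemigroup of $S_{ij}^a$; - $T_1=\operatorname{Reg}(S_{ij}a,\cdot)$, a subsemigroup of $(S_{ij}a,\cdot)$; it equals $P^aa$; - $T_2=\operatorname{Reg}(aS_{ij},\cdot)$, a subsemigroup of $(aS_{ij},\cdot)$; it equals $aP^a$; - $W=(aS_{ij}a,\circledast)$, where $u\circledast v=ubv$, i.e. $axa\circledast aya=axaya$ (independent of the choice of $b\in V(a)$); $W$ is a regular monoid with identity $a$ and underlying set $aP^aa$. There are semigroup epimorphisms $\phi_1:T_1\to W$, $g\mapsto ag$, and $\phi_2:T_2\to W$, $h\mapsto ha$. The pullback product of semigroups $S_1,S_2$ with respect to a semigroup $T$ and epimorphisms $f_k:S_k\to T$ ($k=1,2$) is the subsemigroup $\{(s_1,s_2)\in S_1\times S_2: f_1(s_1)=f_2(s_2)\}$ of $S_1\times S_2$. *)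

theory Defs
  imports "HOL-Algebra.Congruence"
begin

section \<open>Partial semigroups\<close>

text \<open>The partial operation is option-valued: \<open>xy\<close> is defined iff \<open>pmult S x y \<noteq> None\<close>.\<close>

record ('a, 'i) psg = "'a partial_object" +
  pmult :: "'a \<Rightarrow> 'a \<Rightarrow> 'a option"
  objs :: "'i set"
  lam :: "'a \<Rightarrow> 'i"
  rho :: "'a \<Rightarrow> 'i"

text \<open>
  The classes \<open>S\<close> and \<open>I\<close> are sets over two arbitrary types, so the requirement that each
  \<open>S\<^sub>i\<^sub>j\<close> be a set holds automatically and does not appear as an axiom.
\<close>

locale partial_semigroup =
  fixes S :: "('a, 'i) psg"
  assumes lam_closed: "x \<in> carrier S \<Longrightarrow> lam S x \<in> objs S"
    and rho_closed: "x \<in> carrier S \<Longrightarrow> rho S x \<in> objs S"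
    and pmult_closed:
      "\<lbrakk>x \<in> carrier S; y \<in> carrier S; pmult S x y = Some z\<rbrakk> \<Longrightarrow> z \<in> carrier S"
    and pmult_defined_iff:
      "\<lbrakk>x \<in> carrier S; y \<in> carrier S\<rbrakk> \<Longrightarrow> pmult S x y \<noteq> None \<longleftrightarrow> rho S x = lam S y"
    and lam_rho_pmult:
      "\<lbrakk>x \<in> carrier S; y \<in> carrier S; pmult S x y = Some z\<rbrakk>
        \<Longrightarrow> lam S z = lam S x \<and> rho S z = rho S y"
    and pmult_assoc:
      "\<lbrakk>x \<in> carrier S; y \<in> carrier S; z \<in> carrier S;
        pmult S x y = Some u; pmult S y z = Some v\<rbrakk> \<Longrightarrow> pmult S u z = pmult S x v"

definition pmult3 :: "('a, 'i) psg \<Rightarrow> 'a \<Rightarrow> 'a \<Rightarrow> 'a \<Rightarrow> 'a option" where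
  "pmult3 S x y z = Option.bind (pmult S x y) (\<lambda>u. pmult S u z)"

text \<open>
  The operations \<open>prd\<close> and \<open>prd3\<close> give the value of a product and are unspecified
  when it is undefined. They are used below only where the \<open>\<lambda>\<close>/\<open>\<rho>\<close>-types of the
  factors make the product defined. Where definedness is part of the condition
  (as in \<open>x = xyx\<close>), the option-valued versions are used.
\<close>

definition prd :: "('a, 'i) psg \<Rightarrow> 'a \<Rightarrow> 'a \<Rightarrow> 'a" where
  "prd S x y = the (pmult S x y)"

definition prd3 :: "('a, 'i) psg \<Rightarrow> 'a \<Rightarrow> 'a \<Rightarrow> 'a \<Rightarrow> 'a" where
  "prd3 S x y z = the (pmult3 S x y z)"

definition block :: "('a, 'i) psg \<Rightarrow> 'i \<Rightarrow> 'i \<Rightarrow> 'a set" where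
  "block S i j = {x \<in> carrier S. lam S x = i \<and> rho S x = j}"

definition inverses :: "('a, 'i) psg \<Rightarrow> 'a \<Rightarrow> 'a set" where
  "inverses S x =
    {y \<in> carrier S. pmult3 S x y x = Some x \<and> pmult3 S y x y = Some y}"

definition psg_Reg :: "('a, 'i) psg \<Rightarrow> 'a set" where
  "psg_Reg S = {x \<in> carrier S. \<exists>y\<in>carrier S. pmult3 S x y x = Some x}"

section \<open>Semigroups\<close>

record 'a sgrp = "'a partial_object" +
  smult :: "'a \<Rightarrow> 'a \<Rightarrow> 'a"

definition is_semigroup :: "'a sgrp \<Rightarrow> bool" where
  "is_semigroup T \<longleftrightarrow>
    (\<forall>x\<in>carrier T. \<forall>y\<in>carrier T. smult T x y \<in> carrier T) \<and>
    (\<forall>x\<in>carrier T. \<forall>y\<in>carrier T. \<forall>z\<in>carrier T.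
      smult T (smult T x y) z = smult T x (smult T y z))"

definition sgrp_Reg :: "'a sgrp \<Rightarrow> 'a set" where
  "sgrp_Reg T = {x \<in> carrier T. \<exists>y\<in>carrier T. x = smult T (smult T x y) x}"

definition Reg_sub :: "'a sgrp \<Rightarrow> 'a sgrp" where
  "Reg_sub T = T\<lparr>carrier := sgrp_Reg T\<rparr>"

definition semigroup_hom :: "('a \<Rightarrow> 'b) \<Rightarrow> 'a sgrp \<Rightarrow> 'b sgrp \<Rightarrow> bool" where
  "semigroup_hom f T U \<longleftrightarrow>
    f ` carrier T \<subseteq> carrier U \<and>
    (\<forall>x\<in>carrier T. \<forall>y\<in>carrier T. f (smult T x y) = smult U (f x) (f y))"

definition semigroup_epi :: "('a \<Rightarrow> 'b) \<Rightarrow> 'a sgrp \<Rightarrow> 'b sgrp \<Rightarrow> bool" where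
  "semigroup_epi f T U \<longleftrightarrow> semigroup_hom f T U \<and> f ` carrier T = carrier U"

definition semigroup_iso :: "('a \<Rightarrow> 'b) \<Rightarrow> 'a sgrp \<Rightarrow> 'b sgrp \<Rightarrow> bool" where
  "semigroup_iso f T U \<longleftrightarrow> semigroup_hom f T U \<and> bij_betw f (carrier T) (carrier U)"

definition direct_product :: "'a sgrp \<Rightarrow> 'b sgrp \<Rightarrow> ('a \<times> 'b) sgrp" where
  "direct_product T1 T2 =
    \<lparr>carrier = carrier T1 \<times> carrier T2,
     smult = (\<lambda>(x1, x2) (y1, y2). (smult T1 x1 y1, smult T2 x2 y2))\<rparr>"

definition pullback_product ::
  "'a sgrp \<Rightarrow> 'b sgrp \<Rightarrow> ('a \<Rightarrow> 'c) \<Rightarrow> ('b \<Rightarrow> 'c) \<Rightarrow> ('a \<times> 'b) sgrp" where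
  "pullback_product T1 T2 f1 f2 = (direct_product T1 T2)
    \<lparr>carrier := {(s1, s2) \<in> carrier T1 \<times> carrier T2. f1 s1 = f2 s2}\<rparr>"

definition is_pullback_product_via ::
  "('p \<Rightarrow> 'a \<times> 'b) \<Rightarrow> 'p sgrp \<Rightarrow> 'a sgrp \<Rightarrow> 'b sgrp \<Rightarrow> 'c sgrp
    \<Rightarrow> ('a \<Rightarrow> 'c) \<Rightarrow> ('b \<Rightarrow> 'c) \<Rightarrow> bool" where
  "is_pullback_product_via h P T1 T2 U f1 f2 \<longleftrightarrow>
    is_semigroup P \<and> is_semigroup T1 \<and> is_semigroup T2 \<and> is_semigroup U \<and>
    semigroup_epi f1 T1 U \<and> semigroup_epi f2 T2 U \<and>
    semigroup_iso h P (pullback_product T1 T2 f1 f2)"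

section \<open>Sandwich semigroups\<close>

text \<open>Throughout, \<open>a\<close> is meant to lie in \<open>S\<^sub>j\<^sub>i\<close> and \<open>b\<close> in \<open>S\<^sub>i\<^sub>j\<close>.\<close>

definition sandwich :: "('a, 'i) psg \<Rightarrow> 'i \<Rightarrow> 'i \<Rightarrow> 'a \<Rightarrow> 'a sgrp" where
  "sandwich S i j a = \<lparr>carrier = block S i j, smult = (\<lambda>x y. prd3 S x a y)\<rparr>"

definition sandwich_regular :: "('a, 'i) psg \<Rightarrow> 'i \<Rightarrow> 'i \<Rightarrow> 'a \<Rightarrow> bool" where
  "sandwich_regular S i j a \<longleftrightarrow>
    a \<in> block S j i \<and> a \<in> psg_Reg S \<and> (\<lambda>x. prd3 S a x a) ` block S i j \<subseteq> psg_Reg S"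

definition P_sgrp :: "('a, 'i) psg \<Rightarrow> 'i \<Rightarrow> 'i \<Rightarrow> 'a \<Rightarrow> 'a sgrp" where
  "P_sgrp S i j a = Reg_sub (sandwich S i j a)"

definition T1_sgrp :: "('a, 'i) psg \<Rightarrow> 'i \<Rightarrow> 'i \<Rightarrow> 'a \<Rightarrow> 'a sgrp" where
  "T1_sgrp S i j a =
    Reg_sub \<lparr>carrier = (\<lambda>x. prd S x a) ` block S i j, smult = prd S\<rparr>"

definition T2_sgrp :: "('a, 'i) psg \<Rightarrow> 'i \<Rightarrow> 'i \<Rightarrow> 'a \<Rightarrow> 'a sgrp" where
  "T2_sgrp S i j a =
    Reg_sub \<lparr>carrier = (\<lambda>x. prd S a x) ` block S i j, smult = prd S\<rparr>"

definition W_sgrp :: "('a, 'i) psg \<Rightarrow> 'i \<Rightarrow> 'i \<Rightarrow> 'a \<Rightarrow> 'a \<Rightarrow> 'a sgrp" where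
  "W_sgrp S i j a b =
    \<lparr>carrier = (\<lambda>x. prd3 S a x a) ` block S i j, smult = (\<lambda>u v. prd3 S u b v)\<rparr>"

definition phi1 :: "('a, 'i) psg \<Rightarrow> 'a \<Rightarrow> 'a \<Rightarrow> 'a" where
  "phi1 S a g = prd S a g"

definition phi2 :: "('a, 'i) psg \<Rightarrow> 'a \<Rightarrow> 'a \<Rightarrow> 'a" where
  "phi2 S a h = prd S h a"

definition psi :: "('a, 'i) psg \<Rightarrow> 'a \<Rightarrow> 'a \<Rightarrow> 'a \<times> 'a" where
  "psi S a x = (prd S x a, prd S a x)"

end

theory Submission
  imports Defs
begin

text \<open>
  Sandwich-regularity reduces regularity to one-sided conditions. If \<open>x = pax = xaq\<close> and
  \<open>axa = axa z axa\<close>, then \<open>x = p(axa)q = xazax\<close>; hence \<open>x\<close> is regular in \<open>S\<^sub>i\<^sub>j\<^sup>a\<close> iff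
  \<open>x \<in> S\<^sub>i\<^sub>jax \<inter> xaS\<^sub>i\<^sub>j\<close>, and likewise \<open>T\<^sub>1\<close> consists of the \<open>g \<in> S\<^sub>i\<^sub>ja\<close> with \<open>g \<in> S\<^sub>i\<^sub>jag\<close> and \<open>T\<^sub>2\<close> of the
  \<open>h \<in> aS\<^sub>i\<^sub>j\<close> with \<open>h \<in> haS\<^sub>i\<^sub>j\<close>. Given \<open>g = pag\<close> and \<open>h = haq\<close> with \<open>ag = ha\<close>, the element \<open>gq = ph\<close>
  is the preimage of \<open>(g, h)\<close> under \<open>\<psi>\<close>.
\<close>

section \<open>Calculating with products of composable elements\<close>

context partial_semigroup
begin

abbreviation prod_S :: "'a \<Rightarrow> 'a \<Rightarrow> 'a" (infixr "\<cdot>" 70) where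
  "x \<cdot> y \<equiv> prd S x y"

lemma pmult_eq_Some:
  assumes "x \<in> carrier S" "y \<in> carrier S" "rho S x = lam S y"
  shows "pmult S x y = Some (x \<cdot> y)"
  using pmult_defined_iff[of x y] assms by (auto simp: prd_def)

lemma
  assumes "x \<in> carrier S" "y \<in> carrier S" "rho S x = lam S y"
  shows prd_closed [simp]: "x \<cdot> y \<in> carrier S"
    and lam_prd [simp]: "lam S (x \<cdot> y) = lam S x"
    and rho_prd [simp]: "rho S (x \<cdot> y) = rho S y"
  using pmult_closed[OF assms(1,2) pmult_eq_Some[OF assms]]
    lam_rho_pmult[OF assms(1,2) pmult_eq_Some[OF assms]] by auto

text \<open>As a rewrite rule this nests products to the right, matching \<open>infixr\<close>. Its
  side conditions are settled by the rules for \<open>lam\<close> and \<open>rho\<close> of a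
  product.\<close>

lemma prd_assoc [simp]:
  assumes "x \<in> carrier S" "y \<in> carrier S" "z \<in> carrier S"
    "rho S x = lam S y" "rho S y = lam S z"
  shows "(x \<cdot> y) \<cdot> z = x \<cdot> y \<cdot> z"
  using pmult_assoc[OF assms(1-3) pmult_eq_Some pmult_eq_Some] assms by (simp add: prd_def)

lemma pmult3_eq_Some:
  assumes "x \<in> carrier S" "y \<in> carrier S" "z \<in> carrier S"
    "rho S x = lam S y" "rho S y = lam S z"
  shows "pmult3 S x y z = Some (x \<cdot> y \<cdot> z)"
  using assms by (simp add: pmult3_def pmult_eq_Some)

lemma prd3_eq [simp]:
  assumes "x \<in> carrier S" "y \<in> carrier S" "z \<in> carrier S"
    "rho S x = lam S y" "rho S y = lam S z"
  shows "prd3 S x y z = x \<cdot> y \<cdot> z"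
  using pmult3_eq_Some[OF assms] by (simp add: prd3_def)

text \<open>Regularity in \<open>S\<close> only supplies a witness in \<open>carrier S\<close>.
  Definedness of the triple product is what pins down the witness's endpoints.\<close>

lemma pmult3_eq_SomeD:
  assumes "x \<in> carrier S" "y \<in> carrier S" "z \<in> carrier S" "pmult3 S x y z = Some w"
  shows "rho S x = lam S y" "rho S y = lam S z" "x \<cdot> y \<cdot> z = w"
proof -
  from assms(4) obtain u where u: "pmult S x y = Some u" and uz: "pmult S u z = Some w"
    by (auto simp: pmult3_def bind_eq_Some_conv)
  show xy: "rho S x = lam S y"
    using pmult_defined_iff[OF assms(1,2)] u by simp
  have "u \<in> carrier S" "rho S u = rho S y"
    using pmult_closed[OF assms(1,2) u] lam_rho_pmult[OF assms(1,2) u] by auto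
  then show yz: "rho S y = lam S z"
    using pmult_defined_iff[of u z] assms(3) uz by simp
  show "x \<cdot> y \<cdot> z = w"
    using pmult3_eq_Some[OF assms(1-3) xy yz] assms(4) by simp
qed

end

section \<open>The sandwich element and the regularity of \<open>axa\<close>\<close>

locale sandwich_regular_element = partial_semigroup S for S :: "('a, 'i) psg" +
  fixes i j :: 'i and a b :: 'a
  assumes sandwich_reg: "sandwich_regular S i j a"
    and b_inverse: "b \<in> inverses S a"
begin

lemma a_block [simp]: "a \<in> carrier S" "lam S a = j" "rho S a = i"
  using sandwich_reg by (auto simp: sandwich_regular_def block_def)

lemma b_block [simp]: "b \<in> carrier S" "lam S b = i" "rho S b = j"
  and aba [simp]: "a \<cdot> b \<cdot> a = a"
proof -
  show b: "b \<in> carrier S" and "a \<cdot> b \<cdot> a = a"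
    using b_inverse pmult3_eq_SomeD(3)[of a b a a] by (auto simp: inverses_def)
  then show "lam S b = i" "rho S b = j"
    using b_inverse pmult3_eq_SomeD(1,2)[of a b a a] by (auto simp: inverses_def)
qed

text \<open>In right-nested form a product continuing after \<open>a \<cdot> b \<cdot> a\<close>
  contains no instance of \<open>aba\<close>, so the cancellation needs this second form.\<close>

lemma aba_left [simp]:
  assumes "x \<in> carrier S" "lam S x = i"
  shows "a \<cdot> b \<cdot> a \<cdot> x = a \<cdot> x"
proof -
  have "a \<cdot> b \<cdot> a \<cdot> x = (a \<cdot> b \<cdot> a) \<cdot> x"
    \<comment> \<open>With \<open>aba\<close> active, the right side would collapse before it could
      be reassociated.\<close>
    using assms by (simp del: aba)
  then show ?thesis by simp
qed

lemma block_iff [simp]: "x \<in> block S k l \<longleftrightarrow> x \<in> carrier S \<and> lam S x = k \<and> rho S x = l"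
  by (simp add: block_def)

text \<open>The witness \<open>z\<close> for \<open>axa\<close> in \<open>S\<close> composes with
  \<open>axa\<close> on both sides. As \<open>axa\<close> runs from \<open>j\<close> to
  \<open>i\<close>, \<open>z\<close> runs from \<open>i\<close> to \<open>j\<close> and so lies in
  the sandwich semigroup.\<close>

lemma axa_regular:
  assumes "x \<in> block S i j"
  obtains z where "z \<in> block S i j" "a \<cdot> x \<cdot> a \<cdot> z \<cdot> a \<cdot> x \<cdot> a = a \<cdot> x \<cdot> a"
proof -
  have x: "x \<in> carrier S" "lam S x = i" "rho S x = j"
    using assms by auto
  have "a \<cdot> x \<cdot> a \<in> psg_Reg S"
    using sandwich_reg assms x by (force simp: sandwich_regular_def)
  then obtain z where z: "z \<in> carrier S"
    and eq: "pmult3 S (a \<cdot> x \<cdot> a) z (a \<cdot> x \<cdot> a) = Some (a \<cdot> x \<cdot> a)"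
    by (auto simp: psg_Reg_def)
  note D = pmult3_eq_SomeD[OF _ z _ eq]
  have "lam S z = i" "rho S z = j"
    using D(1,2) x by simp_all
  then show thesis
    using that[of z] z D(3) x by simp
qed

section \<open>Regular elements described by one-sided factors\<close>

lemma mem_P_iff:
  "x \<in> carrier (P_sgrp S i j a) \<longleftrightarrow>
    x \<in> block S i j \<and> (\<exists>p\<in>block S i j. p \<cdot> a \<cdot> x = x) \<and> (\<exists>q\<in>block S i j. x \<cdot> a \<cdot> q = x)"
    (is "?P \<longleftrightarrow> ?R")
proof
  assume ?P
  then obtain y where xy: "x \<in> block S i j" "y \<in> block S i j" and eq: "x \<cdot> a \<cdot> y \<cdot> a \<cdot> x = x"
    by (auto simp: P_sgrp_def Reg_sub_def sgrp_Reg_def sandwich_def)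
  have "(x \<cdot> a \<cdot> y) \<cdot> a \<cdot> x = x"
    using xy eq by simp
  with xy eq show ?R
    by (intro conjI bexI[of _ "x \<cdot> a \<cdot> y"] bexI[of _ "y \<cdot> a \<cdot> x"]) auto
next
  assume ?R
  then obtain p q where x: "x \<in> block S i j" and p: "p \<in> block S i j" "p \<cdot> a \<cdot> x = x"
    and q: "q \<in> block S i j" "x \<cdot> a \<cdot> q = x"
    by blast
  obtain z where z: "z \<in> block S i j" "a \<cdot> x \<cdot> a \<cdot> z \<cdot> a \<cdot> x \<cdot> a = a \<cdot> x \<cdot> a"
    using axa_regular[OF x] .
  \<comment> \<open>Placing \<open>x\<close> between \<open>p\<close> and \<open>q\<close> exposes
    \<open>axa\<close>, which is then expanded to \<open>axa z axa\<close>. The outer factors are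
    absorbed again, leaving \<open>x\<close> on both sides of \<open>aza\<close>.\<close>
  have "x = p \<cdot> a \<cdot> x \<cdot> a \<cdot> q"
    using p(2) q(2) by simp
  also have "\<dots> = p \<cdot> (a \<cdot> x \<cdot> a \<cdot> z \<cdot> a \<cdot> x \<cdot> a) \<cdot> q"
    unfolding z(2) using x p(1) q(1) by simp
  also have "\<dots> = (p \<cdot> a \<cdot> x) \<cdot> a \<cdot> z \<cdot> a \<cdot> (x \<cdot> a \<cdot> q)"
    using x p(1) q(1) z(1) by simp
  also have "\<dots> = x \<cdot> a \<cdot> z \<cdot> a \<cdot> x"
    using p(2) q(2) by simp
  finally show ?P
    using x z(1) by (auto simp: P_sgrp_def Reg_sub_def sgrp_Reg_def sandwich_def)
qed

text \<open>For \<open>g = xa\<close> the product \<open>ag\<close> is already \<open>axa\<close>,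
  and \<open>p\<close> recovers \<open>g\<close> from it:
  \<open>g = p(axa) = p(axa)z(axa) = (pag)z(ag) = g(za)g\<close>, with \<open>za\<close> in
  \<open>S_ij a\<close>. Conversely, an inverse \<open>ya\<close> of \<open>g\<close> gives
  \<open>p = gy\<close>.\<close>

lemma mem_T1_iff:
  "g \<in> carrier (T1_sgrp S i j a) \<longleftrightarrow>
    (\<exists>x\<in>block S i j. g = x \<cdot> a) \<and> (\<exists>p\<in>block S i j. p \<cdot> a \<cdot> g = g)"
    (is "?T \<longleftrightarrow> ?R")
proof
  assume ?T
  then obtain x y where xy: "x \<in> block S i j" "y \<in> block S i j" and g: "g = x \<cdot> a"
    and eq: "(g \<cdot> y \<cdot> a) \<cdot> g = g"
    by (auto simp: T1_sgrp_def Reg_sub_def sgrp_Reg_def)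
  have "(g \<cdot> y) \<cdot> a \<cdot> g = g"
    using xy eq by (simp add: g)
  with xy g show ?R
    by (intro conjI bexI[of _ x] bexI[of _ "g \<cdot> y"]) auto
next
  assume ?R
  then obtain x p where x: "x \<in> block S i j" and g: "g = x \<cdot> a"
    and p: "p \<in> block S i j" "p \<cdot> a \<cdot> g = g"
    by blast
  obtain z where z: "z \<in> block S i j" "a \<cdot> x \<cdot> a \<cdot> z \<cdot> a \<cdot> x \<cdot> a = a \<cdot> x \<cdot> a"
    using axa_regular[OF x] .
  have "g = p \<cdot> a \<cdot> x \<cdot> a \<cdot> z \<cdot> a \<cdot> x \<cdot> a"
    unfolding z(2) using p(2) by (simp add: g)
  also have "\<dots> = (p \<cdot> a \<cdot> g) \<cdot> z \<cdot> a \<cdot> g"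
    using x p(1) z(1) by (simp add: g)
  also have "\<dots> = (g \<cdot> z \<cdot> a) \<cdot> g"
    unfolding p(2) using x z(1) by (simp add: g)
  finally show ?T
    using x z(1) g unfolding T1_sgrp_def Reg_sub_def sgrp_Reg_def by auto
qed

text \<open>The left-right dual of \<open>mem_T1_iff\<close>: here \<open>ha = axa\<close>, the
  witness is \<open>az\<close>, and an inverse \<open>ay\<close> of \<open>h\<close> gives
  \<open>q = yh\<close>.\<close>

lemma mem_T2_iff:
  "h \<in> carrier (T2_sgrp S i j a) \<longleftrightarrow>
    (\<exists>x\<in>block S i j. h = a \<cdot> x) \<and> (\<exists>q\<in>block S i j. h \<cdot> a \<cdot> q = h)"
    (is "?T \<longleftrightarrow> ?R")
proof
  assume ?T
  then obtain x y where xy: "x \<in> block S i j" "y \<in> block S i j" and h: "h = a \<cdot> x"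
    and eq: "(h \<cdot> a \<cdot> y) \<cdot> h = h"
    by (auto simp: T2_sgrp_def Reg_sub_def sgrp_Reg_def)
  have "h \<cdot> a \<cdot> y \<cdot> h = h"
    using xy eq by (simp add: h)
  with xy h show ?R
    by (intro conjI bexI[of _ x] bexI[of _ "y \<cdot> h"]) auto
next
  assume ?R
  then obtain x q where x: "x \<in> block S i j" and h: "h = a \<cdot> x"
    and q: "q \<in> block S i j" "h \<cdot> a \<cdot> q = h"
    by blast
  obtain z where z: "z \<in> block S i j" "a \<cdot> x \<cdot> a \<cdot> z \<cdot> a \<cdot> x \<cdot> a = a \<cdot> x \<cdot> a"
    using axa_regular[OF x] .
  have "h = (a \<cdot> x \<cdot> a) \<cdot> q"
    using q x by (simp add: h)
  also have "\<dots> = (a \<cdot> x \<cdot> a \<cdot> z \<cdot> a \<cdot> x \<cdot> a) \<cdot> q"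
    unfolding z(2) ..
  also have "\<dots> = (h \<cdot> a \<cdot> z) \<cdot> h \<cdot> a \<cdot> q"
    using x q(1) z(1) by (simp add: h)
  also have "\<dots> = (h \<cdot> a \<cdot> z) \<cdot> h"
    unfolding q(2) ..
  finally show ?T
    using x z(1) h unfolding T2_sgrp_def Reg_sub_def sgrp_Reg_def by auto
qed

section \<open>The four semigroups\<close>

lemma smult_simps [simp]:
  "smult (P_sgrp S i j a) = (\<lambda>x y. prd3 S x a y)"
  "smult (T1_sgrp S i j a) = prd S"
  "smult (T2_sgrp S i j a) = prd S"
  "smult (W_sgrp S i j a b) = (\<lambda>u v. prd3 S u b v)"
  by (simp_all add: P_sgrp_def T1_sgrp_def T2_sgrp_def W_sgrp_def Reg_sub_def sandwich_def)

lemma mem_W_iff: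
  "u \<in> carrier (W_sgrp S i j a b) \<longleftrightarrow> (\<exists>x\<in>block S i j. u = a \<cdot> x \<cdot> a)"
  by (auto simp: W_sgrp_def image_iff)

lemma P_block: "x \<in> carrier (P_sgrp S i j a) \<Longrightarrow> x \<in> block S i j"
  by (simp add: mem_P_iff)

lemma T1_block: "g \<in> carrier (T1_sgrp S i j a) \<Longrightarrow> g \<in> block S i i"
  by (auto simp: mem_T1_iff)

lemma T2_block: "h \<in> carrier (T2_sgrp S i j a) \<Longrightarrow> h \<in> block S j j"
  by (auto simp: mem_T2_iff)

text \<open>Since \<open>g\<close> ends in \<open>a\<close>, \<open>aba = a\<close> applies at its
  right end. This lets \<open>phi1\<close> absorb the \<open>b\<close> in the product of
  \<open>W\<close>; the next lemma does the same for \<open>phi2\<close>.\<close>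

lemma T1_prd_ba: "g \<in> carrier (T1_sgrp S i j a) \<Longrightarrow> g \<cdot> b \<cdot> a = g"
  by (auto simp: mem_T1_iff)

lemma T2_ab_prd: "h \<in> carrier (T2_sgrp S i j a) \<Longrightarrow> a \<cdot> b \<cdot> h = h"
  by (auto simp: mem_T2_iff)

text \<open>By the one-sided description, \<open>xay\<close> inherits its left factor from
  \<open>x\<close> and its right factor from \<open>y\<close>.\<close>

lemma is_semigroup_P: "is_semigroup (P_sgrp S i j a)"
proof -
  have "x \<cdot> a \<cdot> y \<in> carrier (P_sgrp S i j a)"
    if xP: "x \<in> carrier (P_sgrp S i j a)" and yP: "y \<in> carrier (P_sgrp S i j a)" for x y
  proof -
    obtain p where p: "p \<in> block S i j" "p \<cdot> a \<cdot> x = x"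
      using xP unfolding mem_P_iff by blast
    obtain q where q: "q \<in> block S i j" "y \<cdot> a \<cdot> q = y"
      using yP unfolding mem_P_iff by blast
    have "p \<cdot> a \<cdot> x \<cdot> a \<cdot> y = (p \<cdot> a \<cdot> x) \<cdot> a \<cdot> y"
      "(x \<cdot> a \<cdot> y) \<cdot> a \<cdot> q = x \<cdot> a \<cdot> y \<cdot> a \<cdot> q"
      using P_block[OF xP] P_block[OF yP] p(1) q(1) by simp_all
    then have "p \<cdot> a \<cdot> x \<cdot> a \<cdot> y = x \<cdot> a \<cdot> y" "(x \<cdot> a \<cdot> y) \<cdot> a \<cdot> q = x \<cdot> a \<cdot> y"
      using p(2) q(2) by simp_all
    with P_block[OF xP] P_block[OF yP] p(1) q(1) show ?thesis
      unfolding mem_P_iff by (intro conjI bexI[of _ p] bexI[of _ q]) auto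
  qed
  then show ?thesis
    using P_block by (simp add: is_semigroup_def)
qed

text \<open>The product takes its left factor \<open>p\<close> from the first element and its final
  \<open>a\<close> from the second; for \<open>T2\<close> the roles are exchanged.\<close>

lemma is_semigroup_T1: "is_semigroup (T1_sgrp S i j a)"
proof -
  have "g \<cdot> h \<in> carrier (T1_sgrp S i j a)"
    if gT: "g \<in> carrier (T1_sgrp S i j a)" and hT: "h \<in> carrier (T1_sgrp S i j a)" for g h
  proof -
    obtain p where p: "p \<in> block S i j" "p \<cdot> a \<cdot> g = g"
      using gT unfolding mem_T1_iff by blast
    obtain y where y: "y \<in> block S i j" "h = y \<cdot> a"
      using hT unfolding mem_T1_iff by blast
    have "p \<cdot> a \<cdot> g \<cdot> h = (p \<cdot> a \<cdot> g) \<cdot> h"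
      using T1_block[OF gT] T1_block[OF hT] p(1) by simp
    then have "p \<cdot> a \<cdot> g \<cdot> h = g \<cdot> h"
      using p(2) by simp
    with T1_block[OF gT] p(1) y show ?thesis
      unfolding mem_T1_iff by (intro conjI bexI[of _ p] bexI[of _ "g \<cdot> y"]) auto
  qed
  then show ?thesis
    using T1_block by (simp add: is_semigroup_def)
qed

lemma is_semigroup_T2: "is_semigroup (T2_sgrp S i j a)"
proof -
  have "g \<cdot> h \<in> carrier (T2_sgrp S i j a)"
    if gT: "g \<in> carrier (T2_sgrp S i j a)" and hT: "h \<in> carrier (T2_sgrp S i j a)" for g h
  proof -
    obtain q where q: "q \<in> block S i j" "h \<cdot> a \<cdot> q = h"
      using hT unfolding mem_T2_iff by blast
    obtain x where x: "x \<in> block S i j" "g = a \<cdot> x"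
      using gT unfolding mem_T2_iff by blast
    have "(g \<cdot> h) \<cdot> a \<cdot> q = g \<cdot> h \<cdot> a \<cdot> q"
      using T2_block[OF gT] T2_block[OF hT] q(1) by simp
    then have "(g \<cdot> h) \<cdot> a \<cdot> q = g \<cdot> h"
      using q(2) by simp
    with T2_block[OF hT] q(1) x show ?thesis
      unfolding mem_T2_iff by (intro conjI bexI[of _ q] bexI[of _ "x \<cdot> h"]) auto
  qed
  then show ?thesis
    using T2_block by (simp add: is_semigroup_def)
qed

lemma is_semigroup_W: "is_semigroup (W_sgrp S i j a b)"
proof -
  have "prd3 S u b v \<in> carrier (W_sgrp S i j a b)"
    if uv: "u \<in> carrier (W_sgrp S i j a b)" "v \<in> carrier (W_sgrp S i j a b)" for u v
  proof -
    obtain x y where "x \<in> block S i j" "u = a \<cdot> x \<cdot> a" "y \<in> block S i j" "v = a \<cdot> y \<cdot> a"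
      using uv unfolding mem_W_iff by blast
    \<comment> \<open>After cancelling \<open>aba\<close>,
      \<open>(axa)b(aya) = a(xay)a\<close>.\<close>
    then show ?thesis
      unfolding mem_W_iff by (intro bexI[of _ "x \<cdot> a \<cdot> y"]) auto
  qed
  then show ?thesis
    by (auto simp: is_semigroup_def mem_W_iff)
qed

section \<open>The epimorphisms onto \<open>W\<close>\<close>

lemma phi1_epi: "semigroup_epi (phi1 S a) (T1_sgrp S i j a) (W_sgrp S i j a b)"
proof -
  have into: "a \<cdot> g \<in> carrier (W_sgrp S i j a b)" if "g \<in> carrier (T1_sgrp S i j a)" for g
    using that by (auto simp: mem_T1_iff mem_W_iff)
  have hom: "a \<cdot> g \<cdot> h = prd3 S (a \<cdot> g) b (a \<cdot> h)"
    if g: "g \<in> carrier (T1_sgrp S i j a)" and h: "h \<in> carrier (T1_sgrp S i j a)" for g h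
  proof -
    have "prd3 S (a \<cdot> g) b (a \<cdot> h) = a \<cdot> (g \<cdot> b \<cdot> a) \<cdot> h"
      using T1_block[OF g] T1_block[OF h] by simp
    then show ?thesis
      using T1_prd_ba[OF g] by simp
  qed
  have "u \<in> phi1 S a ` carrier (T1_sgrp S i j a)" if u: "u \<in> carrier (W_sgrp S i j a b)" for u
  proof -
    obtain x where x: "x \<in> block S i j" "u = a \<cdot> x \<cdot> a"
      using u unfolding mem_W_iff by blast
    obtain z where z: "z \<in> block S i j" "a \<cdot> x \<cdot> a \<cdot> z \<cdot> a \<cdot> x \<cdot> a = a \<cdot> x \<cdot> a"
      using axa_regular[OF x(1)] .
    \<comment> \<open>The preimage of \<open>u = axa\<close> is \<open>bu = (bax)a\<close>, because
      \<open>abaxa = axa\<close>. Its left factor \<open>baxaz\<close> works since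
      \<open>(baxaz)a(bu) = b(axa z axa) = bu\<close>.\<close>
    have "b \<cdot> u \<in> carrier (T1_sgrp S i j a)"
      unfolding mem_T1_iff using x z
      by (intro conjI bexI[of _ "b \<cdot> a \<cdot> x"] bexI[of _ "b \<cdot> a \<cdot> x \<cdot> a \<cdot> z"]) auto
    moreover have "u = phi1 S a (b \<cdot> u)"
      using x by (simp add: phi1_def)
    ultimately show ?thesis by blast
  qed
  with into hom show ?thesis
    by (auto simp: semigroup_epi_def semigroup_hom_def phi1_def)
qed

lemma phi2_epi: "semigroup_epi (phi2 S a) (T2_sgrp S i j a) (W_sgrp S i j a b)"
proof -
  have into: "h \<cdot> a \<in> carrier (W_sgrp S i j a b)" if "h \<in> carrier (T2_sgrp S i j a)" for h
    using that by (auto simp: mem_T2_iff mem_W_iff)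
  have hom: "(g \<cdot> h) \<cdot> a = prd3 S (g \<cdot> a) b (h \<cdot> a)"
    if g: "g \<in> carrier (T2_sgrp S i j a)" and h: "h \<in> carrier (T2_sgrp S i j a)" for g h
  proof -
    have "prd3 S (g \<cdot> a) b (h \<cdot> a) = g \<cdot> (a \<cdot> b \<cdot> h) \<cdot> a"
      using T2_block[OF g] T2_block[OF h] by simp
    then show ?thesis
      using T2_ab_prd[OF h] T2_block[OF g] T2_block[OF h] by simp
  qed
  have "u \<in> phi2 S a ` carrier (T2_sgrp S i j a)" if u: "u \<in> carrier (W_sgrp S i j a b)" for u
  proof -
    obtain x where x: "x \<in> block S i j" "u = a \<cdot> x \<cdot> a"
      using u unfolding mem_W_iff by blast
    obtain z where z: "z \<in> block S i j" "a \<cdot> x \<cdot> a \<cdot> z \<cdot> a \<cdot> x \<cdot> a = a \<cdot> x \<cdot> a"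
      using axa_regular[OF x(1)] .
    \<comment> \<open>Dually the preimage is \<open>ub\<close>. The trailing \<open>b\<close> keeps
      the right-nested product from matching \<open>z(2)\<close>, so the regrouping is
      explicit.\<close>
    have "(u \<cdot> b) \<cdot> a \<cdot> z \<cdot> a \<cdot> x \<cdot> a \<cdot> b = (a \<cdot> x \<cdot> a \<cdot> z \<cdot> a \<cdot> x \<cdot> a) \<cdot> b"
      using x z(1) by simp
    also have "\<dots> = u \<cdot> b"
      unfolding z(2) x(2) ..
    finally have "u \<cdot> b \<in> carrier (T2_sgrp S i j a)"
      unfolding mem_T2_iff using x z(1)
      by (intro conjI bexI[of _ "x \<cdot> a \<cdot> b"] bexI[of _ "z \<cdot> a \<cdot> x \<cdot> a \<cdot> b"]) auto
    moreover have "u = phi2 S a (u \<cdot> b)"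
      using x by (simp add: phi2_def)
    ultimately show ?thesis by blast
  qed
  with into hom show ?thesis
    by (auto simp: semigroup_epi_def semigroup_hom_def phi2_def)
qed

lemma psi_inj: "inj_on (psi S a) (carrier (P_sgrp S i j a))"
proof (rule inj_onI)
  fix x y
  assume xP: "x \<in> carrier (P_sgrp S i j a)" and yP: "y \<in> carrier (P_sgrp S i j a)"
    and "psi S a x = psi S a y"
  then have xa: "x \<cdot> a = y \<cdot> a" and ax: "a \<cdot> x = a \<cdot> y"
    by (simp_all add: psi_def)
  obtain q where q: "q \<in> block S i j" "x \<cdot> a \<cdot> q = x"
    using xP unfolding mem_P_iff by blast
  obtain p where p: "p \<in> block S i j" "p \<cdot> a \<cdot> y = y"
    using yP unfolding mem_P_iff by blast
  note blocks = P_block[OF xP] P_block[OF yP] p(1) q(1)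
  \<comment> \<open>With \<open>q\<close> taken from \<open>x\<close> and \<open>p\<close> from
    \<open>y\<close>, the chain is
    \<open>x = (xa)q = (ya)q = p(ay)aq = p(ax)aq = p(ax) = p(ay) = y\<close>.\<close>
  have "x = (x \<cdot> a) \<cdot> q"
    using q(2) blocks by simp
  also have "\<dots> = (p \<cdot> a \<cdot> y) \<cdot> a \<cdot> q"
    unfolding xa p(2) using blocks by simp
  also have "\<dots> = p \<cdot> (a \<cdot> x) \<cdot> a \<cdot> q"
    unfolding ax using blocks by simp
  also have "\<dots> = p \<cdot> a \<cdot> x \<cdot> a \<cdot> q"
    using blocks by simp
  also have "\<dots> = y"
    using p(2) q(2) ax by simp
  finally show "x = y" .
qed

text \<open>The left factor \<open>p\<close> of \<open>x\<close> also serves \<open>xa\<close>, and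
  the right factor \<open>q\<close> also serves \<open>ax\<close>.\<close>

lemma psi_into:
  assumes xP: "x \<in> carrier (P_sgrp S i j a)"
  shows "x \<cdot> a \<in> carrier (T1_sgrp S i j a)" "a \<cdot> x \<in> carrier (T2_sgrp S i j a)"
proof -
  obtain p q where pq: "p \<in> block S i j" "p \<cdot> a \<cdot> x = x" "q \<in> block S i j" "x \<cdot> a \<cdot> q = x"
    using xP unfolding mem_P_iff by blast
  have "p \<cdot> a \<cdot> x \<cdot> a = (p \<cdot> a \<cdot> x) \<cdot> a" "(a \<cdot> x) \<cdot> a \<cdot> q = a \<cdot> x \<cdot> a \<cdot> q"
    using P_block[OF xP] pq(1,3) by simp_all
  then have "p \<cdot> a \<cdot> x \<cdot> a = x \<cdot> a" "(a \<cdot> x) \<cdot> a \<cdot> q = a \<cdot> x"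
    using pq(2,4) by simp_all
  then show "x \<cdot> a \<in> carrier (T1_sgrp S i j a)" "a \<cdot> x \<in> carrier (T2_sgrp S i j a)"
    using P_block[OF xP] pq(1,3) unfolding mem_T1_iff mem_T2_iff by blast+
qed

lemma psi_onto:
  assumes gT: "g \<in> carrier (T1_sgrp S i j a)" and hT: "h \<in> carrier (T2_sgrp S i j a)"
    and gh: "a \<cdot> g = h \<cdot> a"
  obtains x where "x \<in> carrier (P_sgrp S i j a)" "x \<cdot> a = g" "a \<cdot> x = h"
proof -
  obtain p where p: "p \<in> block S i j" "p \<cdot> a \<cdot> g = g"
    using gT unfolding mem_T1_iff by blast
  obtain q where q: "q \<in> block S i j" "h \<cdot> a \<cdot> q = h"
    using hT unfolding mem_T2_iff by blast
  note blocks = T1_block[OF gT] T2_block[OF hT] p(1) q(1)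
  \<comment> \<open>Both expressions equal \<open>p(ag)q = p(ha)q\<close>. The form
    \<open>ph\<close> yields \<open>(ph)a = p(ag) = g\<close>, while \<open>gq\<close> yields
    \<open>a(gq) = (ha)q = h\<close>.\<close>
  have gq: "g \<cdot> q = p \<cdot> h"
  proof -
    have "g \<cdot> q = (p \<cdot> a \<cdot> g) \<cdot> q"
      by (simp only: p(2))
    also have "\<dots> = p \<cdot> (a \<cdot> g) \<cdot> q"
      using blocks by simp
    also have "\<dots> = p \<cdot> h \<cdot> a \<cdot> q"
      unfolding gh using blocks by simp
    finally show ?thesis
      using q(2) by simp
  qed
  have right: "(g \<cdot> q) \<cdot> a = g"
    unfolding gq using p gh blocks by simp
  have left: "a \<cdot> g \<cdot> q = h"
  proof -
    have "a \<cdot> g \<cdot> q = (a \<cdot> g) \<cdot> q"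
      using blocks by simp
    then show ?thesis
      unfolding gh using q(2) blocks by simp
  qed
  \<comment> \<open>The same \<open>p\<close> and \<open>q\<close> are one-sided factors of the new
    element, which places it in \<open>P_sgrp\<close>.\<close>
  have "p \<cdot> a \<cdot> g \<cdot> q = g \<cdot> q" "(g \<cdot> q) \<cdot> a \<cdot> q = g \<cdot> q"
  proof -
    show "p \<cdot> a \<cdot> g \<cdot> q = g \<cdot> q"
      unfolding left by (rule gq[symmetric])
    have "(g \<cdot> q) \<cdot> a \<cdot> q = ((g \<cdot> q) \<cdot> a) \<cdot> q"
      using blocks by simp
    then show "(g \<cdot> q) \<cdot> a \<cdot> q = g \<cdot> q"
      by (simp only: right)
  qed
  with blocks have "g \<cdot> q \<in> carrier (P_sgrp S i j a)"
    unfolding mem_P_iff by (intro conjI bexI[of _ p] bexI[of _ q]) auto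
  then show thesis
    using that right left by blast
qed

lemma psi_image:
  "psi S a ` carrier (P_sgrp S i j a) =
    {(g, h) \<in> carrier (T1_sgrp S i j a) \<times> carrier (T2_sgrp S i j a). a \<cdot> g = h \<cdot> a}"
    (is "_ = ?Q")
proof
  show "psi S a ` carrier (P_sgrp S i j a) \<subseteq> ?Q"
    using psi_into P_block by (auto simp: psi_def)
  show "?Q \<subseteq> psi S a ` carrier (P_sgrp S i j a)"
  proof clarify
    fix g h
    assume "g \<in> carrier (T1_sgrp S i j a)" "h \<in> carrier (T2_sgrp S i j a)" "a \<cdot> g = h \<cdot> a"
    then obtain x where "x \<in> carrier (P_sgrp S i j a)" "x \<cdot> a = g" "a \<cdot> x = h"
      by (rule psi_onto)
    then show "(g, h) \<in> psi S a ` carrier (P_sgrp S i j a)"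
      by (intro image_eqI[of _ _ x]) (auto simp: psi_def)
  qed
qed

lemma psi_iso:
  "semigroup_iso (psi S a) (P_sgrp S i j a)
    (pullback_product (T1_sgrp S i j a) (T2_sgrp S i j a) (phi1 S a) (phi2 S a))"
    (is "semigroup_iso _ ?P ?Q")
proof -
  have im: "psi S a ` carrier ?P = carrier ?Q"
    unfolding psi_image by (simp add: pullback_product_def phi1_def phi2_def)
  \<comment> \<open>Both coordinates only need reassociation: \<open>(xay)a = (xa)(ya)\<close> and
    \<open>a(xay) = (ax)(ay)\<close>.\<close>
  have "psi S a (smult ?P x y) = smult ?Q (psi S a x) (psi S a y)"
    if "x \<in> carrier ?P" "y \<in> carrier ?P" for x y
    using P_block[OF that(1)] P_block[OF that(2)]
    by (simp add: psi_def pullback_product_def direct_product_def)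
  with im psi_inj show ?thesis
    by (simp add: semigroup_iso_def semigroup_hom_def bij_betw_def)
qed

end

theorem theorem2p10:
  fixes S :: "('a, 'i) psg" and i j :: 'i and a b :: 'a
  assumes "partial_semigroup S"
    and "i \<in> objs S" and "j \<in> objs S"
    and "sandwich_regular S i j a"
    and "b \<in> inverses S a"
  shows "inj_on (psi S a) (carrier (P_sgrp S i j a)) \<and>
    psi S a ` carrier (P_sgrp S i j a) =
      {(g, h) \<in> carrier (T1_sgrp S i j a) \<times> carrier (T2_sgrp S i j a).
        prd S a g = prd S h a} \<and>
    {(g, h) \<in> carrier (T1_sgrp S i j a) \<times> carrier (T2_sgrp S i j a).
        prd S a g = prd S h a} =
      {(g, h) \<in> carrier (T1_sgrp S i j a) \<times> carrier (T2_sgrp S i j a).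
        phi1 S a g = phi2 S a h} \<and>
    is_pullback_product_via (psi S a) (P_sgrp S i j a)
      (T1_sgrp S i j a) (T2_sgrp S i j a) (W_sgrp S i j a b) (phi1 S a) (phi2 S a)"
proof -
  interpret sandwich_regular_element S i j a b
    using assms by (intro sandwich_regular_element.intro sandwich_regular_element_axioms.intro)
  have "is_pullback_product_via (psi S a) (P_sgrp S i j a)
      (T1_sgrp S i j a) (T2_sgrp S i j a) (W_sgrp S i j a b) (phi1 S a) (phi2 S a)"
    unfolding is_pullback_product_via_def
    using is_semigroup_P is_semigroup_T1 is_semigroup_T2 is_semigroup_W
      phi1_epi phi2_epi psi_iso by blast
  then show ?thesis
    using psi_inj psi_image by (simp add: phi1_def phi2_def)
qed

end
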